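(* For every $n\ge1$, the map $F\mapsto c(F)$ is a bijection from the set of pointed Lyndon forests with leaf label set $[n]$ to the set of saturated chains of $\Pi_n^\bullet$ starting at $\hat0$ that are ascent-free with respect to $\lambda_\bullet$.
   Context: Pointed partitions: a pointed set is $A^p$ with $A$ nonempty finite, $p\in A$; a pointed partition of $[n]$ is a collection of pointed sets whose underlying sets partition $[n]$. In $\Pi_n^\bullet$, $\pi\lessdot\pi'$ when $\pi'$ arises by replacing two blocks $A^p,B^q$ ($\min A<\min B$) by $(A\cup B)^p$ (1-merge) or $(A\cup B)^q$ (0-merge); $\hat0$ is the partition into singletons. $\lambda_\bullet$ labels a $u$-merge by $(\min A,\min B)^u\in\Lambda_n^\bullet$, where $\Lambda_n^\bullet$ has elements $(a,b)^u$ ($1\le a<b\le n$, $u\in\{0,1\}$), ordered as the ordinal sum $A_1\oplus C_1\oplus\cdots\oplus A_{n-1}\oplus C_{n-1}$, $A_a$ the antichain $\{(a,b)^0\}$ and $C_a$ the chain $\{(a,b)^1\}$ with $(a,b)^1<(a,c)^1$ iff $b<c$. A saturated chain is ascent-free if no two consecutive labels $\ell_i,\ell_{i+1}$ satisfy $\ell_i<\ell_{i+1}$. Trees: a bicolored binary forest on $[n]$ is a forest of rooted planar binary trees (every internal vertex has a left child $L(v)$ and a right child $R(v)$), whose leaves are bijectively labeled by $[n]$, each internal vertex $v$ having a color $\mathrm{color}(v)\in\{0,1\}$. The valency $\nu(v)$ is the smallest leaf label in the subtree rooted at $v$. The forest is normalized if $\nu(v)=\nu(L(v))$ for every internal $v$.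 An internal vertex $v$ is Lyndon if $L(v)$ is a leaf or $\nu(R(L(v)))>\nu(R(v))$. A normalized bicolored binary tree is a pointed Lyndon tree if every internal vertex $v$ whose left child is internal satisfies $\mathrm{color}(L(v))\ge\mathrm{color}(v)$, and, if $\mathrm{color}(L(v))=\mathrm{color}(v)=1$, $v$ is Lyndon. A pointed Lyndon forest is a forest all of whose components are pointed Lyndon trees. The reverse-minimal linear extension of a normalized forest is the unique ordering $v_1,\dots,v_k$ of its internal vertices in which each vertex precedes its parent and $\nu(v_1)\ge\cdots\ge\nu(v_k)$. For such a forest $F$, $c(F)$ is the chain in $\Pi_n^\bullet$ starting at $\hat0$ whose $i$-th step merges the two blocks consisting of the leaf labels of the left and right subtrees of $v_i$, keeping the pointed element of the left block if $\mathrm{color}(v_i)=1$ and of the right block if $\mathrm{color}(v_i)=0$; equivalently its label sequence is $(\nu(L(v_1)),\nu(R(v_1)))^{\mathrm{color}(v_1)}\cdots(\nu(L(v_k)),\nu(R(v_k)))^{\mathrm{color}(v_k)}$. *)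

theory Defs
  imports "HOL-Library.Disjoint_Sets"
begin

section \<open>Pointed partitions\<close>

text \<open>The pointed set \<open>A\<^sup>p\<close> is the pair \<open>(A, p)\<close>.\<close>

type_synonym pointed_partition = "(nat set \<times> nat) set"

definition pointed_partitions :: "nat \<Rightarrow> pointed_partition set" where
  "pointed_partitions n =
     {\<pi>. (\<forall>(A, p) \<in> \<pi>. p \<in> A) \<and> inj_on fst \<pi> \<and> partition_on {1..n} (fst ` \<pi>)}"

definition zero_hat :: "nat \<Rightarrow> pointed_partition" where
  "zero_hat n = (\<lambda>i. ({i}, i)) ` {1..n}"

text \<open>The label \<open>(a, b)\<^sup>u\<close> is the triple \<open>(a, b, u)\<close>. Throughout, elements of
  \<open>{0, 1}\<close> (the superscripts \<open>u\<close> and the colors of vertices) are Booleans,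
  with \<open>False\<close> for \<open>0\<close> and \<open>True\<close> for \<open>1\<close>, ordered by \<open>False < True\<close>.\<close>

type_synonym label = "nat \<times> nat \<times> bool"

text \<open>The strict order of the ordinal sum \<open>A\<^sub>1 \<oplus> C\<^sub>1 \<oplus> \<dots> \<oplus> A\<^sub>n\<^sub>-\<^sub>1 \<oplus> C\<^sub>n\<^sub>-\<^sub>1\<close>, where \<open>A\<^sub>a\<close> is
  the antichain of the \<open>(a, b)\<^sup>0\<close> and \<open>C\<^sub>a\<close> the chain of the \<open>(a, b)\<^sup>1\<close>. The relation does not
  depend on \<open>n\<close>, which only bounds the entries of the labels.\<close>

fun label_less :: "label \<Rightarrow> label \<Rightarrow> bool" where
  "label_less (a, b, u) (c, d, v) \<longleftrightarrow>
     a < c \<or> (a = c \<and> ((\<not> u \<and> v) \<or> (u \<and> v \<and> b < d)))"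

definition merges_to :: "pointed_partition \<Rightarrow> label \<Rightarrow> pointed_partition \<Rightarrow> bool" where
  "merges_to \<pi> l \<pi>' \<longleftrightarrow>
     (\<exists>A p B q u. (A, p) \<in> \<pi> \<and> (B, q) \<in> \<pi> \<and> Min A < Min B \<and> l = (Min A, Min B, u) \<and>
        \<pi>' = insert (A \<union> B, if u then p else q) (\<pi> - {(A, p), (B, q)}))"

definition covered_by :: "pointed_partition \<Rightarrow> pointed_partition \<Rightarrow> bool" where
  "covered_by \<pi> \<pi>' \<longleftrightarrow> (\<exists>l. merges_to \<pi> l \<pi>')"

definition edge_label :: "pointed_partition \<Rightarrow> pointed_partition \<Rightarrow> label" where
  "edge_label \<pi> \<pi>' = (THE l. merges_to \<pi> l \<pi>')"

definition saturated_chains_from_zero :: "nat \<Rightarrow> pointed_partition list set" where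
  "saturated_chains_from_zero n =
     {cs. cs \<noteq> [] \<and> hd cs = zero_hat n \<and> set cs \<subseteq> pointed_partitions n \<and>
        (\<forall>i. Suc i < length cs \<longrightarrow> covered_by (cs ! i) (cs ! Suc i))}"

definition chain_labels :: "pointed_partition list \<Rightarrow> label list" where
  "chain_labels cs = map (\<lambda>i. edge_label (cs ! i) (cs ! Suc i)) [0..<length cs - 1]"

definition ascent_free :: "pointed_partition list \<Rightarrow> bool" where
  "ascent_free cs \<longleftrightarrow>
     (\<forall>i. Suc i < length (chain_labels cs) \<longrightarrow>
        \<not> label_less (chain_labels cs ! i) (chain_labels cs ! Suc i))"


section \<open>Bicolored binary forests\<close>

datatype btree = Leaf nat | Node (color: bool) (left: btree) (right: btree)

fun leaves :: "btree \<Rightarrow> nat list" where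
  "leaves (Leaf i) = [i]"
| "leaves (Node c l r) = leaves l @ leaves r"

abbreviation leaf_set :: "btree \<Rightarrow> nat set" where
  "leaf_set t \<equiv> set (leaves t)"

text \<open>A vertex is represented by the subtree rooted at it. In a forest with
  pairwise distinct leaf labels, different vertices have different subtrees.\<close>

fun internal :: "btree \<Rightarrow> btree set" where
  "internal (Leaf i) = {}"
| "internal (Node c l r) = insert (Node c l r) (internal l \<union> internal r)"

definition valency :: "btree \<Rightarrow> nat" where
  "valency v = Min (leaf_set v)"

definition is_leaf :: "btree \<Rightarrow> bool" where
  "is_leaf v \<longleftrightarrow> (\<exists>i. v = Leaf i)"

definition lyndon_vertex :: "btree \<Rightarrow> bool" where
  "lyndon_vertex v \<longleftrightarrow> is_leaf (left v) \<or> valency (right (left v)) > valency (right v)"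

definition normalized :: "btree \<Rightarrow> bool" where
  "normalized t \<longleftrightarrow> (\<forall>v \<in> internal t. valency v = valency (left v))"

definition pointed_lyndon_tree :: "btree \<Rightarrow> bool" where
  "pointed_lyndon_tree t \<longleftrightarrow> normalized t \<and>
     (\<forall>v \<in> internal t. \<not> is_leaf (left v) \<longrightarrow>
        color (left v) \<ge> color v \<and>
        (color (left v) = True \<and> color v = True \<longrightarrow> lyndon_vertex v))"

text \<open>The components of a forest are not ordered, so a forest is a set of trees.\<close>

definition bicolored_forest :: "nat \<Rightarrow> btree set \<Rightarrow> bool" where
  "bicolored_forest n F \<longleftrightarrow>
     (\<forall>t \<in> F. distinct (leaves t)) \<and> disjoint_family_on leaf_set F \<and>
     (\<Union>t \<in> F. leaf_set t) = {1..n}"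

definition pointed_lyndon_forests :: "nat \<Rightarrow> btree set set" where
  "pointed_lyndon_forests n =
     {F. bicolored_forest n F \<and> (\<forall>t \<in> F. pointed_lyndon_tree t)}"

definition is_reverse_minimal_extension :: "btree set \<Rightarrow> btree list \<Rightarrow> bool" where
  "is_reverse_minimal_extension F vs \<longleftrightarrow>
     distinct vs \<and> set vs = (\<Union>t \<in> F. internal t) \<and>
     (\<forall>i < length vs. \<forall>j < length vs.
        vs ! i = left (vs ! j) \<or> vs ! i = right (vs ! j) \<longrightarrow> i < j) \<and>
     sorted_wrt (\<lambda>v w. valency v \<ge> valency w) vs"

definition reverse_minimal_extension :: "btree set \<Rightarrow> btree list" where
  "reverse_minimal_extension F = (THE vs. is_reverse_minimal_extension F vs)"

definition point_of :: "pointed_partition \<Rightarrow> nat set \<Rightarrow> nat" where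
  "point_of \<pi> A = (THE p. (A, p) \<in> \<pi>)"

definition merge_at :: "pointed_partition \<Rightarrow> btree \<Rightarrow> pointed_partition" where
  "merge_at \<pi> v =
     (let A = leaf_set (left v); B = leaf_set (right v); p = point_of \<pi> A; q = point_of \<pi> B
      in insert (A \<union> B, if color v then p else q) (\<pi> - {(A, p), (B, q)}))"

fun merge_chain :: "pointed_partition \<Rightarrow> btree list \<Rightarrow> pointed_partition list" where
  "merge_chain \<pi> [] = [\<pi>]"
| "merge_chain \<pi> (v # vs) = \<pi> # merge_chain (merge_at \<pi> v) vs"

definition forest_chain :: "nat \<Rightarrow> btree set \<Rightarrow> pointed_partition list" where
  "forest_chain n F = merge_chain (zero_hat n) (reverse_minimal_extension F)"

end

theory Submission
  imports Defs
begin

text \<open>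
  A saturated chain from \<open>\<hat>0\<close> is the same thing as a sequence of vertices
  \<open>v\<^sub>1, \<dots>, v\<^sub>k\<close> in which every \<open>v\<^sub>i\<close> joins two components of the forest built so far, the one
  of smaller valency being on the left; in particular the forest is always normalized. If the
  labels have no ascents, the valencies of the \<open>v\<^sub>i\<close> weakly decrease, so
  \<open>v\<^sub>1, \<dots>, v\<^sub>k\<close> is the reverse-minimal linear extension of the final forest. In such a
  sequence \<open>v\<^sub>i\<close> and \<open>v\<^sub>i\<^sub>+\<^sub>1\<close> have equal valency iff \<open>L(v\<^sub>i\<^sub>+\<^sub>1)\<close> is internal, and then
  \<open>L(v\<^sub>i\<^sub>+\<^sub>1) = v\<^sub>i\<close>; hence the absence of an ascent at \<open>i\<close> is exactly the pointed Lyndon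
  condition at \<open>v\<^sub>i\<^sub>+\<^sub>1\<close>.
\<close>

section \<open>Forests\<close>

lemma leaves_nonempty [simp]: "leaves t \<noteq> []"
  by (induction t) auto

lemma valency_in: "valency t \<in> leaf_set t"
  unfolding valency_def by (rule Min_in) auto

lemma valency_le: "i \<in> leaf_set t \<Longrightarrow> valency t \<le> i"
  unfolding valency_def by (rule Min_le) auto

lemma valency_Node: "valency (Node c l r) = min (valency l) (valency r)"
  unfolding valency_def by (simp add: Min_Un)

lemma internal_leaf_set: "v \<in> internal t \<Longrightarrow> leaf_set v \<subseteq> leaf_set t"
  by (induction t) auto

lemma finite_internal [simp]: "finite (internal t)"
  by (induction t) auto

lemma internal_not_leaf: "v \<in> internal t \<Longrightarrow> \<exists>c l r. v = Node c l r"
  by (induction t) auto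

lemma internal_refl: "\<not> is_leaf t \<Longrightarrow> t \<in> internal t"
  by (cases t) (auto simp: is_leaf_def)

lemma internal_parent:
  "v \<in> internal t \<Longrightarrow> v = t \<or> (\<exists>w \<in> internal t. v = left w \<or> v = right w)"
  by (induction t) auto

lemma internal_child:
  "w \<in> internal t \<Longrightarrow> \<not> is_leaf (left w) \<Longrightarrow> left w \<in> internal t"
  "w \<in> internal t \<Longrightarrow> \<not> is_leaf (right w) \<Longrightarrow> right w \<in> internal t"
  by (induction t) (auto simp: internal_refl)

section \<open>Normalized forests and the joining of two components\<close>

definition normalized_forest :: "nat \<Rightarrow> btree set \<Rightarrow> bool" where
  "normalized_forest n F \<longleftrightarrow> bicolored_forest n F \<and> (\<forall>t \<in> F. normalized t)"

definition forest_internal :: "btree set \<Rightarrow> btree set" where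
  "forest_internal F = (\<Union>t \<in> F. internal t)"

definition join :: "btree set \<Rightarrow> bool \<Rightarrow> btree \<Rightarrow> btree \<Rightarrow> btree set" where
  "join F c l r = insert (Node c l r) (F - {l, r})"

lemma forest_eqI:
  assumes "bicolored_forest n F" "s \<in> F" "t \<in> F" "i \<in> leaf_set s" "i \<in> leaf_set t"
  shows "s = t"
  using assms unfolding bicolored_forest_def disjoint_family_on_def by blast

text \<open>Components have disjoint leaf sets, and each contains its own valency. This recovery of
  a component from its minimum drives the later uniqueness arguments.\<close>

lemma valency_inj: "bicolored_forest n F \<Longrightarrow> inj_on valency F"
  by (rule inj_onI) (metis forest_eqI valency_in)

lemma finite_forest:
  assumes "bicolored_forest n F" shows "finite F"
proof -
  have "valency ` F \<subseteq> {1..n}"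
    using assms valency_in unfolding bicolored_forest_def by blast
  then show ?thesis
    using valency_inj[OF assms] finite_subset finite_imageD by blast
qed

lemma Node_neq_child: "Node c l r \<noteq> l" "Node c l r \<noteq> r" "l \<noteq> Node c l r" "r \<noteq> Node c l r"
  by (auto dest: arg_cong[of _ _ size])

text \<open>A tree of \<open>F\<close> containing this vertex would share leaves with both
  \<open>l\<close> and \<open>r\<close>, hence equal both. So each join contributes a genuinely new
  internal vertex.\<close>

lemma join_not_internal:
  assumes "bicolored_forest n F" "l \<in> F" "r \<in> F" "l \<noteq> r"
  shows "Node c l r \<notin> forest_internal F"
proof
  assume "Node c l r \<in> forest_internal F"
  then obtain t where t: "t \<in> F" "Node c l r \<in> internal t"
    unfolding forest_internal_def by blast
  have "leaf_set l \<subseteq> leaf_set t" "leaf_set r \<subseteq> leaf_set t"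
    using internal_leaf_set[OF t(2)] by auto
  then show False
    using forest_eqI[OF assms(1) t(1)] assms valency_in by (metis subsetD)
qed

lemma normalized_Node:
  "normalized (Node c l r) \<longleftrightarrow> normalized l \<and> normalized r \<and> valency l \<le> valency r"
  unfolding normalized_def by (auto simp: valency_Node)

lemma normalized_forest_join:
  assumes "normalized_forest n F" "l \<in> F" "r \<in> F" "valency l < valency r"
  shows "normalized_forest n (join F c l r)"
proof -
  have bf: "bicolored_forest n F" and norm: "\<And>t. t \<in> F \<Longrightarrow> normalized t"
    using assms(1) unfolding normalized_forest_def by auto
  have disj: "leaf_set s \<inter> leaf_set t = {}" if "s \<in> F" "t \<in> F" "s \<noteq> t" for s t
    using forest_eqI[OF bf that(1,2)] that(3) by blast
  have "l \<noteq> r" using assms(4) by auto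
  have "distinct (leaves t)" if "t \<in> join F c l r" for t
    using that bf disj[OF assms(2,3) \<open>l \<noteq> r\<close>] assms(2,3) unfolding join_def bicolored_forest_def
    by auto
  moreover have "disjoint_family_on leaf_set (join F c l r)"
    unfolding disjoint_family_on_def
  proof (intro ballI impI)
    fix s t assume "s \<in> join F c l r" "t \<in> join F c l r" "s \<noteq> t"
    then show "leaf_set s \<inter> leaf_set t = {}"
      using disj[of s t] disj[of l s] disj[of r s] disj[of l t] disj[of r t] assms(2,3)
      by (auto simp: join_def)
  qed
  moreover have "(\<Union>t \<in> join F c l r. leaf_set t) = (\<Union>t \<in> F. leaf_set t)"
    using assms(2,3) by (auto simp: join_def)
  moreover have "normalized t" if "t \<in> join F c l r" for t
    using that norm assms(2-4) by (auto simp: join_def normalized_Node)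
  ultimately show ?thesis
    using bf unfolding normalized_forest_def bicolored_forest_def by auto
qed

lemma forest_internal_join:
  assumes "l \<in> F" "r \<in> F"
  shows "forest_internal (join F c l r) = insert (Node c l r) (forest_internal F)"
  using assms unfolding forest_internal_def join_def by auto

text \<open>Deleting a root undoes a join. Normalization gives only a weak inequality of the two
  valencies; distinctness of the leaf labels makes it strict.\<close>

lemma split_root:
  assumes F: "normalized_forest n F" and t: "Node c l r \<in> F"
  obtains G where "normalized_forest n G" "l \<in> G" "r \<in> G" "valency l < valency r"
    "F = join G c l r"
proof
  let ?G = "insert l (insert r (F - {Node c l r}))"
  have bf: "bicolored_forest n F" using F unfolding normalized_forest_def by blast
  have d: "distinct (leaves (Node c l r))"
    using bf t unfolding bicolored_forest_def by blast
  have dl: "leaf_set (Node c l r) \<inter> leaf_set s = {}" if "s \<in> F" "s \<noteq> Node c l r" for s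
    using forest_eqI[OF bf that(1) t] that by blast
  have U: "(\<Union>t \<in> F. leaf_set t) = {1..n}" using bf unfolding bicolored_forest_def by blast
  have "(\<Union>t \<in> ?G. leaf_set t) = (\<Union>t \<in> F. leaf_set t)" using t by fastforce
  then show "normalized_forest n ?G"
    using F t d dl U unfolding normalized_forest_def bicolored_forest_def disjoint_family_on_def
    by (auto simp: normalized_Node)
  show "valency l < valency r"
  proof -
    have "valency l \<le> valency r"
      using F t unfolding normalized_forest_def by (auto simp: normalized_Node)
    moreover have "valency l \<noteq> valency r"
      using d valency_in[of l] valency_in[of r] by auto
    ultimately show ?thesis by simp
  qed
  \<comment> \<open>The join removes \<open>l\<close> and \<open>r\<close>, so it restores
    \<open>F\<close> only if neither was already a component there.\<close>
  have "l \<notin> F" "r \<notin> F"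
    using dl[of l] dl[of r] valency_in[of l] valency_in[of r] by (auto simp: Node_neq_child)
  then show "F = join ?G c l r"
    using t unfolding join_def by (auto simp: Node_neq_child)
qed auto

text \<open>The link between chains and linear extensions: the order of the vertices is recorded,
  with no condition on valencies yet. Since vertices are appended, the latest one is always a root,
  and inductions peel sequences from the end.\<close>

inductive builds :: "nat \<Rightarrow> btree list \<Rightarrow> btree set \<Rightarrow> bool" for n where
  Nil: "builds n [] (Leaf ` {1..n})"
| snoc: "builds n vs F \<Longrightarrow> l \<in> F \<Longrightarrow> r \<in> F \<Longrightarrow> valency l < valency r \<Longrightarrow>
    builds n (vs @ [Node c l r]) (join F c l r)"

lemma builds_snocE:
  assumes "builds n (vs @ [v]) F"
  obtains G c l r where "builds n vs G" "v = Node c l r" "l \<in> G" "r \<in> G" "valency l < valency r"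
    "F = join G c l r"
  using assms by (cases rule: builds.cases) auto

lemma builds_normalized_forest: "builds n vs F \<Longrightarrow> normalized_forest n F"
proof (induction rule: builds.induct)
  case Nil
  then show ?case
    unfolding normalized_forest_def bicolored_forest_def disjoint_family_on_def normalized_def
    by auto
qed (rule normalized_forest_join)

lemma builds_forest: "builds n vs F \<Longrightarrow> bicolored_forest n F"
  using builds_normalized_forest normalized_forest_def by blast

lemma builds_set: "builds n vs F \<Longrightarrow> set vs = forest_internal F"
  by (induction rule: builds.induct) (auto simp: forest_internal_join, simp add: forest_internal_def)

lemma builds_last_in: "builds n vs F \<Longrightarrow> vs \<noteq> [] \<Longrightarrow> last vs \<in> F"
  by (cases rule: builds.cases) (auto simp: join_def)


section \<open>Reverse-minimal extensions\<close>

abbreviation valency_decreasing :: "btree list \<Rightarrow> bool" where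
  "valency_decreasing \<equiv> sorted_wrt (\<lambda>v w. valency v \<ge> valency w)"

definition children_first :: "btree list \<Rightarrow> bool" where
  "children_first vs \<longleftrightarrow> (\<forall>i < length vs. \<forall>j < length vs.
     vs ! i = left (vs ! j) \<or> vs ! i = right (vs ! j) \<longrightarrow> i < j)"

lemma children_first_snoc:
  "children_first (vs @ [w]) \<longleftrightarrow>
     children_first vs \<and> (\<forall>v \<in> set (vs @ [w]). w \<noteq> left v \<and> w \<noteq> right v)"
proof (intro iffI conjI ballI)
  assume cf: "children_first (vs @ [w])"
  show "children_first vs"
    unfolding children_first_def
  proof (intro allI impI)
    fix i j assume "i < length vs" "j < length vs" "vs ! i = left (vs ! j) \<or> vs ! i = right (vs ! j)"
    then show "i < j"
      using cf[unfolded children_first_def, rule_format, of i j] by (simp add: nth_append)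
  qed
  fix v assume "v \<in> set (vs @ [w])"
  then obtain j where "j < length (vs @ [w])" "(vs @ [w]) ! j = v"
    by (auto simp: in_set_conv_nth simp del: set_append length_append)
  then show "w \<noteq> left v" "w \<noteq> right v"
    using cf[unfolded children_first_def, rule_format, of "length vs" j] by auto
next
  assume *: "children_first vs \<and> (\<forall>v \<in> set (vs @ [w]). w \<noteq> left v \<and> w \<noteq> right v)"
  show "children_first (vs @ [w])"
    unfolding children_first_def
  proof (intro allI impI)
    fix i j assume ij: "i < length (vs @ [w])" "j < length (vs @ [w])"
      "(vs @ [w]) ! i = left ((vs @ [w]) ! j) \<or> (vs @ [w]) ! i = right ((vs @ [w]) ! j)"
    have "i \<noteq> length vs"
      using * ij(3) nth_mem[OF ij(2)] by (metis nth_append_length)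
    then have "i < length vs" using ij(1) by simp
    show "i < j"
    proof (cases "j < length vs")
      case True
      have "vs ! i = left (vs ! j) \<or> vs ! i = right (vs ! j)"
        using ij(3) True \<open>i < length vs\<close> by (simp only: nth_append if_True)
      then show ?thesis using * True \<open>i < length vs\<close> unfolding children_first_def by blast
    qed (use \<open>i < length vs\<close> in simp)
  qed
qed

lemma rme_iff:
  "is_reverse_minimal_extension F vs \<longleftrightarrow>
     distinct vs \<and> set vs = forest_internal F \<and> children_first vs \<and> valency_decreasing vs"
  unfolding is_reverse_minimal_extension_def children_first_def forest_internal_def by blast

text \<open>A child of an earlier vertex is a leaf or an internal vertex of the current forest, and
  the new vertex is neither.\<close>

lemma builds_distinct_children_first:
  "builds n vs F \<Longrightarrow> distinct vs \<and> children_first vs"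
proof (induction rule: builds.induct)
  case Nil
  then show ?case by (simp add: children_first_def)
next
  case (snoc vs F l r c)
  let ?w = "Node c l r"
  have w: "?w \<notin> forest_internal F"
    using join_not_internal[OF builds_forest] snoc by blast
  have "?w \<noteq> left v \<and> ?w \<noteq> right v" if "v \<in> set vs" for v
  proof -
    obtain t where t: "t \<in> F" "v \<in> internal t"
      using \<open>v \<in> set vs\<close> builds_set[OF snoc(1)] unfolding forest_internal_def by auto
    have "u \<noteq> ?w" if "\<not> is_leaf u \<Longrightarrow> u \<in> internal t" for u
      using that w t(1) unfolding forest_internal_def is_leaf_def by auto
    then show ?thesis using internal_child[OF t(2)] by metis
  qed
  then show ?case
    using snoc.IH w builds_set[OF snoc(1)] by (auto simp: children_first_snoc Node_neq_child)
qed

lemma builds_rme: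
  "builds n vs F \<Longrightarrow> valency_decreasing vs \<Longrightarrow> is_reverse_minimal_extension F vs"
  using builds_distinct_children_first builds_set by (auto simp: rme_iff)

text \<open>The last vertex of a linear extension has no parent, hence is the root of a component;
  splitting it leaves a smaller forest extended by the remaining vertices.\<close>

lemma rme_builds:
  "normalized_forest n F \<Longrightarrow> is_reverse_minimal_extension F vs \<Longrightarrow> builds n vs F"
proof (induction vs arbitrary: F rule: rev_induct)
  case Nil
  have leaf: "is_leaf t" if "t \<in> F" for t
    using Nil(2) that internal_refl[of t] unfolding rme_iff forest_internal_def by auto
  have "F = Leaf ` {1..n}"
  proof -
    have U: "(\<Union>t \<in> F. leaf_set t) = {1..n}"
      using Nil(1) unfolding normalized_forest_def bicolored_forest_def by blast
    have "t \<in> Leaf ` {1..n}" if "t \<in> F" for t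
    proof -
      obtain i where "t = Leaf i" using leaf[OF \<open>t \<in> F\<close>] unfolding is_leaf_def by blast
      then have "i \<in> (\<Union>t \<in> F. leaf_set t)" using \<open>t \<in> F\<close> by force
      then show ?thesis using U \<open>t = Leaf i\<close> by simp
    qed
    moreover have "Leaf i \<in> F" if "i \<in> {1..n}" for i
    proof -
      obtain t where "t \<in> F" "i \<in> leaf_set t" using U \<open>i \<in> {1..n}\<close> by blast
      then show ?thesis using leaf[of t] unfolding is_leaf_def by auto
    qed
    ultimately show ?thesis by blast
  qed
  then show ?case using builds.Nil by simp
next
  case (snoc w vs)
  have e: "distinct (vs @ [w])" "set (vs @ [w]) = forest_internal F"
    "children_first (vs @ [w])" "valency_decreasing (vs @ [w])"
    using snoc(3) unfolding rme_iff by auto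
  obtain t where t: "t \<in> F" "w \<in> internal t"
    using e(2) unfolding forest_internal_def by auto
  have "w = t"
  proof (rule ccontr)
    assume "w \<noteq> t"
    then obtain v where "v \<in> internal t" "w = left v \<or> w = right v"
      using internal_parent t(2) by blast
    moreover have "v \<in> set (vs @ [w])"
      using \<open>v \<in> internal t\<close> t e(2) unfolding forest_internal_def by blast
    ultimately show False using e(3) unfolding children_first_snoc by blast
  qed
  moreover obtain c l r where w: "w = Node c l r" using internal_not_leaf[OF t(2)] by blast
  ultimately have "Node c l r \<in> F" using t by simp
  then obtain G where G: "normalized_forest n G" "l \<in> G" "r \<in> G" "valency l < valency r"
    "F = join G c l r"
    using split_root[OF snoc(2)] by blast
  \<comment> \<open>Allows the last vertex to be cancelled from both sides of the equality of vertex
    sets.\<close>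
  have "Node c l r \<notin> forest_internal G"
    using join_not_internal[of n G l r c] G unfolding normalized_forest_def by auto
  then have "set vs = forest_internal G"
    using e(1,2) G w by (simp add: forest_internal_join insert_ident)
  then have "is_reverse_minimal_extension G vs"
    using e unfolding rme_iff children_first_snoc by (simp add: sorted_wrt_append)
  then show ?case using snoc.IH[OF G(1)] builds.snoc G w by blast
qed

lemma sorted_last_min:
  "valency_decreasing (vs @ [w]) \<Longrightarrow> v \<in> set (vs @ [w]) \<Longrightarrow> valency w \<le> valency v"
  by (auto simp: sorted_wrt_append)

text \<open>Both sequences end in a vertex of least valency among all internal vertices, and both
  last vertices are components of \<open>F\<close>. Components have distinct valencies, so the last
  vertices agree.\<close>

lemma builds_unique:
  "builds n vs F \<Longrightarrow> valency_decreasing vs \<Longrightarrow> builds n ws F \<Longrightarrow> valency_decreasing ws \<Longrightarrow> vs = ws"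
proof (induction vs arbitrary: F ws rule: rev_induct)
  case Nil
  then show ?case using builds_set[OF Nil(1)] builds_set[OF Nil(3)] by simp
next
  case (snoc v vs)
  have set_eq: "set (vs @ [v]) = set ws"
    using builds_set[OF snoc(2)] builds_set[OF snoc(4)] by simp
  then obtain us w where ws: "ws = us @ [w]" by (cases ws rule: rev_cases) auto
  have "valency v = valency w"
    using sorted_last_min[OF snoc(3), of w] sorted_last_min[of us w v] snoc(5) set_eq ws
    by (metis in_set_conv_decomp order_antisym)
  moreover have "v \<in> F" "w \<in> F"
    using builds_last_in[OF snoc(2)] builds_last_in[OF snoc(4)] ws by auto
  ultimately have vw: "v = w"
    using valency_inj[OF builds_forest[OF snoc(2)]] by (simp add: inj_on_def)
  obtain G c l r where G: "builds n vs G" "v = Node c l r" "l \<in> G" "r \<in> G"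
    "F = join G c l r" "valency l < valency r" using builds_snocE[OF snoc(2)] by metis
  obtain H c' l' r' where H: "builds n us H" "w = Node c' l' r'" "l' \<in> H" "r' \<in> H"
    "F = join H c' l' r'" "valency l' < valency r'"
    using builds_snocE[of n us w F] snoc(4) ws by metis
  \<comment> \<open>The forest before the last join depends only on \<open>F\<close> and
    \<open>v\<close>, so both sequences without their last vertex build the same forest.\<close>
  have undo: "K = insert l (insert r (F - {v}))"
    if "builds n zs K" "l \<in> K" "r \<in> K" "F = join K c l r" for K zs
  proof -
    have "v \<notin> K"
      using join_not_internal[OF builds_forest[OF that(1)], of l r c] that G(2,6)
      unfolding forest_internal_def by fastforce
    then show ?thesis using that G(2) unfolding join_def by auto
  qed
  have "G = H" using undo[OF G(1)] undo[OF H(1)] G H vw by auto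
  then show ?case
    using snoc.IH[OF G(1) _ , of us] H(1) snoc(3,5) ws vw by (auto simp: sorted_wrt_append)
qed

text \<open>The last vertex is the component of smallest valency among those that are not leaves.\<close>

lemma builds_exists:
  "normalized_forest n F \<Longrightarrow> \<exists>vs. builds n vs F \<and> valency_decreasing vs"
proof (induction "card (forest_internal F)" arbitrary: F rule: less_induct)
  case less
  have bf: "bicolored_forest n F" using less(2) unfolding normalized_forest_def by blast
  have fin: "finite (forest_internal F)"
    using finite_forest[OF bf] unfolding forest_internal_def by auto
  show ?case
  proof (cases "forest_internal F = {}")
    case True
    then have "is_reverse_minimal_extension F []"
      by (simp add: rme_iff children_first_def)
    then show ?thesis using rme_builds[OF less(2)] by force
  next
    case False
    define T where "T = {t \<in> F. \<not> is_leaf t}"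
    have "finite T" "T \<noteq> {}"
      using finite_forest[OF bf] False unfolding T_def forest_internal_def is_leaf_def
      by auto
    then obtain t where t: "t \<in> T" "\<And>s. s \<in> T \<Longrightarrow> valency t \<le> valency s"
      using arg_min_if_finite(1) arg_min_least by metis
    then obtain c l r where w: "t = Node c l r" "t \<in> F"
      unfolding T_def is_leaf_def by (cases t) auto
    then obtain G where G: "normalized_forest n G" "l \<in> G" "r \<in> G" "valency l < valency r"
      "F = join G c l r"
      using split_root[OF less(2)] by blast
    have "t \<notin> forest_internal G"
      using join_not_internal[of n G l r c] G w unfolding normalized_forest_def by auto
    moreover have FG: "forest_internal F = insert t (forest_internal G)"
      using G w by (simp add: forest_internal_join)
    ultimately have "card (forest_internal G) < card (forest_internal F)"
      using fin by simp
    then obtain vs where vs: "builds n vs G" "valency_decreasing vs"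
      using less(1) G(1) by blast
    \<comment> \<open>A vertex has at least the valency of the root of its tree, so the minimum over
      the components that are not leaves bounds all internal vertices.\<close>
    have "valency t \<le> valency v" if "v \<in> set vs" for v
    proof -
      have "v \<in> forest_internal F" using that builds_set[OF vs(1)] FG by simp
      then obtain s where s: "s \<in> F" "v \<in> internal s" unfolding forest_internal_def by blast
      then have "s \<in> T" unfolding T_def is_leaf_def by auto
      moreover have "valency s \<le> valency v"
        using internal_leaf_set[OF s(2)] valency_in valency_le by blast
      ultimately show ?thesis using t(2) by fastforce
    qed
    then have "valency_decreasing (vs @ [t])" using vs(2) by (simp add: sorted_wrt_append)
    moreover have "builds n (vs @ [t]) F" using builds.snoc[OF vs(1) G(2-4)] G w by simp
    ultimately show ?thesis by blast
  qed
qed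

lemma reverse_minimal_extension_eq:
  assumes "builds n vs F" "valency_decreasing vs"
  shows "reverse_minimal_extension F = vs"
  unfolding reverse_minimal_extension_def
proof (rule the_equality)
  show "is_reverse_minimal_extension F vs" using builds_rme assms by blast
  show "ws = vs" if "is_reverse_minimal_extension F ws" for ws
    using rme_builds[OF builds_normalized_forest[OF assms(1)] that] that builds_unique assms
    unfolding rme_iff by blast
qed


section \<open>Chains\<close>

text \<open>Following the colors down from the root leads to the element that stays pointed through
  all merges. Hence the pointed partition reached depends on the forest alone, not on the order of
  the joins.\<close>

fun point :: "btree \<Rightarrow> nat" where
  "point (Leaf i) = i"
| "point (Node c l r) = (if c then point l else point r)"

definition block :: "btree \<Rightarrow> nat set \<times> nat" where
  "block t = (leaf_set t, point t)"

definition vertex_label :: "btree \<Rightarrow> label" where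
  "vertex_label v = (valency (left v), valency (right v), color v)"

lemma point_in: "point t \<in> leaf_set t"
  by (induction t) auto

lemma block_inj: "bicolored_forest n F \<Longrightarrow> inj_on block F"
  by (rule inj_onI) (metis forest_eqI valency_in block_def prod.inject)

lemma blocks_pointed_partition:
  assumes "bicolored_forest n F"
  shows "block ` F \<in> pointed_partitions n"
proof -
  have "inj_on fst (block ` F)"
    by (rule inj_onI) (use forest_eqI[OF assms] valency_in in \<open>force simp: block_def\<close>)
  moreover have "fst ` block ` F = leaf_set ` F" by (auto simp: block_def image_image)
  moreover have "partition_on {1..n} (leaf_set ` F)"
    using assms forest_eqI[OF assms] unfolding bicolored_forest_def
    by (intro partition_onI) (auto simp: disjnt_def)
  ultimately show ?thesis
    unfolding pointed_partitions_def using point_in by (auto simp: block_def)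
qed

lemma blocks_join:
  assumes "bicolored_forest n F" "l \<in> F" "r \<in> F"
  shows "block ` join F c l r =
    insert (leaf_set l \<union> leaf_set r, if c then point l else point r)
      (block ` F - {block l, block r})"
  using inj_on_image_set_diff[OF block_inj[OF assms(1)], of F "{l, r}"] assms
  unfolding join_def by (auto simp: block_def)

section \<open>Joins of components as covers of pointed partitions\<close>

lemma merges_to_join:
  assumes "bicolored_forest n F" "l \<in> F" "r \<in> F" "valency l < valency r"
  shows "merges_to (block ` F) (vertex_label (Node c l r)) (block ` join F c l r)"
proof -
  have "block l \<in> block ` F" "block r \<in> block ` F" using assms by auto
  moreover have "vertex_label (Node c l r) = (Min (leaf_set l), Min (leaf_set r), c)"
    by (simp add: vertex_label_def valency_def)
  ultimately show ?thesis
    using assms(4) unfolding merges_to_def blocks_join[OF assms(1-3)] block_def valency_def by blast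
qed

lemma merge_at_join:
  assumes "bicolored_forest n F" "l \<in> F" "r \<in> F"
  shows "merge_at (block ` F) (Node c l r) = block ` join F c l r"
proof -
  have "point_of (block ` F) (leaf_set t) = point t" if "t \<in> F" for t
    unfolding point_of_def
  proof (rule the_equality)
    show "(leaf_set t, point t) \<in> block ` F" using that by (auto simp: block_def)
    show "p = point t" if "(leaf_set t, p) \<in> block ` F" for p
      using that forest_eqI[OF assms(1) _ \<open>t \<in> F\<close> _ valency_in] valency_in[of t]
      by (auto simp: block_def)
  qed
  then show ?thesis
    using assms unfolding merge_at_def blocks_join[OF assms] by (simp add: block_def Let_def)
qed

text \<open>Lifts an arbitrary cover to forests: the merged blocks come from two components, and the
  type of the merge becomes the color of the new root.\<close>

lemma merges_to_joinE:
  assumes "bicolored_forest n F" "merges_to (block ` F) a \<pi>"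
  obtains c l r where "l \<in> F" "r \<in> F" "valency l < valency r" "\<pi> = block ` join F c l r"
proof -
  obtain A p B q u where *: "(A, p) \<in> block ` F" "(B, q) \<in> block ` F" "Min A < Min B"
    "\<pi> = insert (A \<union> B, if u then p else q) (block ` F - {(A, p), (B, q)})"
    using assms(2) unfolding merges_to_def by blast
  obtain l r where lr: "l \<in> F" "r \<in> F" "block l = (A, p)" "block r = (B, q)"
    using *(1,2) by force
  have "valency l < valency r" using *(3) lr by (simp add: block_def valency_def)
  moreover have "\<pi> = block ` join F u l r"
    using *(4) lr unfolding blocks_join[OF assms(1) lr(1,2)] by (simp add: block_def)
  ultimately show thesis using that lr by blast
qed

text \<open>The label is read off from the two blocks lost and the one gained: the minima order the
  lost blocks, and the surviving point reveals the type. This makes \<open>edge_label\<close> well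
  defined.\<close>

lemma merges_to_unique:
  assumes pi: "\<pi> \<in> pointed_partitions n" and m: "merges_to \<pi> a \<pi>'" "merges_to \<pi> b \<pi>'"
  shows "a = b"
proof -
  have pt: "p \<in> A" if "(A, p) \<in> \<pi>" for A p
    using pi that unfolding pointed_partitions_def by auto
  have dj: "A = B \<and> p = q" if "(A, p) \<in> \<pi>" "(B, q) \<in> \<pi>" "x \<in> A" "x \<in> B" for A p B q x
  proof -
    have "inj_on fst \<pi>" and disj: "disjoint (fst ` \<pi>)"
      using pi unfolding pointed_partitions_def partition_on_def by auto
    have "A \<in> fst ` \<pi>" "B \<in> fst ` \<pi>" using that(1,2) by force+
    then have "A = B" using disjointD[OF disj] that(3,4) by blast
    then show ?thesis using inj_onD[OF \<open>inj_on fst \<pi>\<close> _ that(1,2)] by simp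
  qed
  have diff: "\<pi> - \<pi>' = {(A, p), (B, q)} \<and> \<pi>' - \<pi> = {(A \<union> B, if u then p else q)} \<and> p \<noteq> q"
    if "(A, p) \<in> \<pi>" "(B, q) \<in> \<pi>" "Min A < Min B"
      "\<pi>' = insert (A \<union> B, if u then p else q) (\<pi> - {(A, p), (B, q)})" for A p B q u
  proof -
    \<comment> \<open>A block of this form would meet, hence equal, both \<open>A\<close> and
      \<open>B\<close>. So the merged block is really new and \<open>\<pi>' - \<pi>\<close> isolates
      it.\<close>
    have "(A \<union> B, x) \<notin> \<pi>" for x
    proof
      assume "(A \<union> B, x) \<in> \<pi>"
      then have "A \<union> B = A" "A \<union> B = B"
        using dj[of "A \<union> B" x A p p] dj[of "A \<union> B" x B q q] that pt by blast+
      then show False using that(3) by simp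
    qed
    moreover have "p \<noteq> q" using dj[of A p B q p] that pt by auto
    ultimately show ?thesis using that by auto
  qed
  obtain A p B q u where 1: "(A, p) \<in> \<pi>" "(B, q) \<in> \<pi>" "Min A < Min B" "a = (Min A, Min B, u)"
    "\<pi>' = insert (A \<union> B, if u then p else q) (\<pi> - {(A, p), (B, q)})"
    using m(1) unfolding merges_to_def by blast
  obtain A' p' B' q' u' where 2: "(A', p') \<in> \<pi>" "(B', q') \<in> \<pi>" "Min A' < Min B'"
    "b = (Min A', Min B', u')"
    "\<pi>' = insert (A' \<union> B', if u' then p' else q') (\<pi> - {(A', p'), (B', q')})"
    using m(2) unfolding merges_to_def by blast
  note d = diff[OF 1(1-3,5)] diff[OF 2(1-3,5)]
  have "{(A, p), (B, q)} = {(A', p'), (B', q')}"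
    by (rule trans[OF sym[OF d(1)[THEN conjunct1]] d(2)[THEN conjunct1]])
  then have AB: "A = A'" "B = B'" "p = p'" "q = q'"
    using 1(3) 2(3) unfolding doubleton_eq_iff by auto
  have "{(A \<union> B, if u then p else q)} = {(A' \<union> B', if u' then p' else q')}"
    by (rule trans[OF sym[OF d(1)[THEN conjunct2, THEN conjunct1]]
          d(2)[THEN conjunct2, THEN conjunct1]])
  \<comment> \<open>The two points differ, since they lie in disjoint blocks, so a 0-merge and a
    1-merge of the same pair give different results.\<close>
  then have "u = u'" using AB d(1)[THEN conjunct2, THEN conjunct2] by (auto split: if_splits)
  then show ?thesis using AB 1(4) 2(4) by simp
qed

lemma edge_label_join:
  assumes "bicolored_forest n F" "l \<in> F" "r \<in> F" "valency l < valency r"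
  shows "edge_label (block ` F) (block ` join F c l r) = vertex_label (Node c l r)"
  unfolding edge_label_def
  using merges_to_join[OF assms] merges_to_unique[OF blocks_pointed_partition[OF assms(1)]]
  by (intro the_equality) auto

section \<open>Saturated chains as building sequences\<close>

lemma merge_chain_nonempty [simp]: "merge_chain \<pi> vs \<noteq> []"
  by (cases vs) auto

lemma merge_chain_snoc:
  "merge_chain \<pi> (vs @ [v]) = merge_chain \<pi> vs @ [merge_at (last (merge_chain \<pi> vs)) v]"
  by (induction \<pi> vs rule: merge_chain.induct) auto

lemma last_merge_chain: "builds n vs F \<Longrightarrow> last (merge_chain (zero_hat n) vs) = block ` F"
proof (induction rule: builds.induct)
  case Nil
  then show ?case by (auto simp: zero_hat_def block_def image_image)
next
  case (snoc vs F l r c)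
  then show ?case by (simp add: merge_chain_snoc merge_at_join[OF builds_forest])
qed

lemma merge_chain_builds_snoc:
  assumes "builds n vs F" "l \<in> F" "r \<in> F"
  shows "merge_chain (zero_hat n) (vs @ [Node c l r]) =
    merge_chain (zero_hat n) vs @ [block ` join F c l r]"
  using assms last_merge_chain[OF assms(1)] merge_at_join[OF builds_forest[OF assms(1)]]
  by (simp add: merge_chain_snoc)

lemma saturated_chains_successively:
  "cs \<in> saturated_chains_from_zero n \<longleftrightarrow>
     cs \<noteq> [] \<and> hd cs = zero_hat n \<and> set cs \<subseteq> pointed_partitions n \<and> successively covered_by cs"
  unfolding saturated_chains_from_zero_def successively_conv_nth by auto

lemma merge_chain_saturated:
  "builds n vs F \<Longrightarrow> merge_chain (zero_hat n) vs \<in> saturated_chains_from_zero n"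
proof (induction rule: builds.induct)
  case Nil
  have "zero_hat n = block ` Leaf ` {1..n}" by (auto simp: zero_hat_def block_def image_image)
  then show ?case
    using blocks_pointed_partition[OF builds_forest[OF builds.Nil]]
    by (simp add: saturated_chains_successively)
next
  case (snoc vs F l r c)
  have "covered_by (block ` F) (block ` join F c l r)"
    using merges_to_join[OF builds_forest[OF snoc(1)] snoc(2-4)] unfolding covered_by_def by blast
  moreover have "block ` join F c l r \<in> pointed_partitions n"
    using blocks_pointed_partition[OF builds_forest[OF builds.snoc[OF snoc(1-4)]]] .
  ultimately show ?case
    using snoc last_merge_chain[OF snoc(1)]
    by (simp add: merge_chain_builds_snoc saturated_chains_successively successively_append_iff)
qed

text \<open>Covers are lifted one by one: the chain without its last element ends at the blocks of a
  forest already built, and the last cover is a join in that forest.\<close>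

lemma saturated_chain_builds:
  "cs \<in> saturated_chains_from_zero n \<Longrightarrow> \<exists>vs F. builds n vs F \<and> cs = merge_chain (zero_hat n) vs"
proof (induction cs rule: rev_induct)
  case Nil
  then show ?case by (simp add: saturated_chains_successively)
next
  case (snoc \<pi> cs)
  show ?case
  proof (cases "cs = []")
    case True
    then show ?thesis
      using snoc(2) builds.Nil by (force simp: saturated_chains_successively)
  next
    case False
    then obtain vs F where vs: "builds n vs F" "cs = merge_chain (zero_hat n) vs"
      using snoc by (auto simp: saturated_chains_successively successively_append_iff)
    have "covered_by (block ` F) \<pi>"
      using snoc(2) False last_merge_chain[OF vs(1)] vs(2)
      by (simp add: saturated_chains_successively successively_append_iff)
    then obtain c l r where "l \<in> F" "r \<in> F" "valency l < valency r" "\<pi> = block ` join F c l r"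
      using merges_to_joinE[OF builds_forest[OF vs(1)]] unfolding covered_by_def by metis
    then show ?thesis
      using builds.snoc[OF vs(1)] merge_chain_builds_snoc[OF vs(1)] vs(2) by metis
  qed
qed

lemma chain_labels_snoc:
  "cs \<noteq> [] \<Longrightarrow> chain_labels (cs @ [\<pi>]) = chain_labels cs @ [edge_label (last cs) \<pi>]"
  by (cases cs rule: rev_cases) (auto simp: chain_labels_def nth_append)

lemma chain_labels_merge_chain:
  "builds n vs F \<Longrightarrow> chain_labels (merge_chain (zero_hat n) vs) = map vertex_label vs"
proof (induction rule: builds.induct)
  case Nil
  then show ?case by (simp add: chain_labels_def)
next
  case (snoc vs F l r c)
  then show ?case
    using last_merge_chain[OF snoc(1)] edge_label_join[OF builds_forest[OF snoc(1)] snoc(2-4)]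
    by (simp add: merge_chain_builds_snoc chain_labels_snoc)
qed

text \<open>The components of a forest have distinct valencies, so the labels determine the two
  components joined in each step.\<close>

lemma labels_determine_forest:
  "builds n vs F \<Longrightarrow> builds n ws G \<Longrightarrow> map vertex_label vs = map vertex_label ws \<Longrightarrow> vs = ws \<and> F = G"
proof (induction vs arbitrary: F ws G rule: rev_induct)
  case Nil
  then have "F = Leaf ` {1..n}" "G = Leaf ` {1..n}"
    by (auto elim: builds.cases)
  then show ?case using Nil by simp
next
  case (snoc v vs)
  obtain us w where ws: "ws = us @ [w]" using snoc(4) by (cases ws rule: rev_cases) auto
  have lab: "map vertex_label vs = map vertex_label us" "vertex_label v = vertex_label w"
    using snoc(4) ws by auto
  obtain F' c l r where F': "builds n vs F'" "v = Node c l r" "l \<in> F'" "r \<in> F'" "F = join F' c l r"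
    using builds_snocE[OF snoc(2)] by metis
  obtain G' c' l' r' where G': "builds n us G'" "w = Node c' l' r'" "l' \<in> G'" "r' \<in> G'"
    "G = join G' c' l' r'"
    using builds_snocE[of n us w G] snoc(3) ws by metis
  have IH: "vs = us" "F' = G'" using snoc.IH[OF F'(1) G'(1) lab(1)] by auto
  have "l = l'" "r = r'" "c = c'"
    using lab(2) F' G' IH valency_inj[OF builds_forest[OF F'(1)]]
    by (auto simp: vertex_label_def dest: inj_onD)
  then show ?case using IH F' G' ws by simp
qed


section \<open>Ascents\<close>

text \<open>The coloring and Lyndon requirements at a single vertex, so that they can be tested when
  this vertex is appended.\<close>

definition lyndon_condition :: "btree \<Rightarrow> bool" where
  "lyndon_condition v \<longleftrightarrow> (\<not> is_leaf (left v) \<longrightarrow>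
     color (left v) \<ge> color v \<and> (color (left v) = True \<and> color v = True \<longrightarrow> lyndon_vertex v))"

abbreviation no_ascents :: "btree list \<Rightarrow> bool" where
  "no_ascents \<equiv> successively (\<lambda>v w. \<not> label_less (vertex_label v) (vertex_label w))"

text \<open>The comparison of labels splits by the valencies of the last vertex and of
  \<open>l\<close>, both components of \<open>F\<close>. A larger valency of \<open>l\<close> is an
  ascent and violates the order; equality leaves the colors and right valencies to compare; a
  smaller one is a descent.\<close>

lemma no_ascent_at_join:
  assumes b: "builds n vs F" and lr: "l \<in> F" "r \<in> F" "valency l < valency r"
    and dec: "valency_decreasing vs" and ne: "vs \<noteq> []"
  shows "\<not> label_less (vertex_label (last vs)) (vertex_label (Node c l r)) \<longleftrightarrow>
    valency (Node c l r) \<le> valency (last vs) \<and> lyndon_condition (Node c l r)"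
proof -
  let ?w = "Node c l r"
  have bf: "bicolored_forest n F" using builds_forest[OF b] .
  obtain us v where vs: "vs = us @ [v]" using ne by (cases vs rule: rev_cases) auto
  obtain d x y where v: "v = Node d x y" "valency x < valency y"
    using builds_snocE[of n us v F] b vs by metis
  have vF: "v \<in> F" using builds_last_in[OF b ne] vs by simp
  have val: "valency v = valency x" "valency ?w = valency l"
    using v lr(3) by (auto simp: valency_Node)
  consider "valency v < valency l" | "valency v = valency l" | "valency l < valency v"
    by linarith
  then show ?thesis
  proof cases
    case 1
    then show ?thesis using val v vs by (simp add: vertex_label_def)
  next
    case 2
    then have l: "l = v" using valency_inj[OF bf] vF lr(1) by (simp add: inj_on_def)
    \<comment> \<open>The absence of an ascent gives only a weak inequality here, whereas a Lyndon
      vertex needs a strict one.\<close>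
    have "valency y \<noteq> valency r"
      using forest_eqI[OF bf vF lr(2), of "valency r"] valency_in[of y] valency_in[of r] l v lr(3)
      by auto
    then show ?thesis
      using 2 val v vs l
      by (auto simp: vertex_label_def lyndon_condition_def lyndon_vertex_def is_leaf_def)
  next
    case 3
    \<comment> \<open>An internal \<open>l\<close> would be among the earlier vertices, whose
      valencies are at least that of \<open>v\<close>. For a leaf the Lyndon condition is
      vacuous.\<close>
    have "is_leaf l"
    proof (rule ccontr)
      assume "\<not> is_leaf l"
      then have "l \<in> set vs"
        using internal_refl lr(1) builds_set[OF b] unfolding forest_internal_def by blast
      then show False using sorted_last_min[of us v l] dec vs 3 by simp
    qed
    then show ?thesis using 3 val v vs by (simp add: vertex_label_def lyndon_condition_def)
  qed
qed

text \<open>The step criterion requires a decreasing prefix, which the induction hypothesis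
  supplies: local absence of ascents thus yields the global order.\<close>

lemma no_ascents_iff:
  "builds n vs F \<Longrightarrow>
     no_ascents vs \<longleftrightarrow> valency_decreasing vs \<and> (\<forall>v \<in> set vs. lyndon_condition v)"
proof (induction rule: builds.induct)
  case Nil
  then show ?case by simp
next
  case (snoc vs F l r c)
  let ?w = "Node c l r"
  show ?case
  proof (cases "vs = []")
    case True
    \<comment> \<open>The first vertex joins two leaves and so satisfies the Lyndon condition
      trivially.\<close>
    then have "F = Leaf ` {1..n}" using snoc(1) by (auto elim: builds.cases)
    then show ?thesis using True snoc(2) by (auto simp: lyndon_condition_def is_leaf_def)
  next
    case False
    have "valency_decreasing (vs @ [?w]) \<longleftrightarrow>
        valency_decreasing vs \<and> valency ?w \<le> valency (last vs)"
      using False sorted_last_min[of "butlast vs" "last vs"]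
      by (auto simp: sorted_wrt_append intro: order_trans)
    then show ?thesis
      using snoc.IH no_ascent_at_join[OF snoc(1-4), of c] False
      by (auto simp: successively_append_iff)
  qed
qed

lemma ascent_free_merge_chain:
  "builds n vs F \<Longrightarrow> ascent_free (merge_chain (zero_hat n) vs) \<longleftrightarrow> no_ascents vs"
  unfolding ascent_free_def successively_conv_nth by (auto simp: chain_labels_merge_chain)

section \<open>Pointed Lyndon forests and the bijection\<close>

lemma pointed_lyndon_forest_iff:
  "F \<in> pointed_lyndon_forests n \<longleftrightarrow>
     normalized_forest n F \<and> (\<forall>v \<in> forest_internal F. lyndon_condition v)"
  unfolding pointed_lyndon_forests_def pointed_lyndon_tree_def normalized_forest_def
    forest_internal_def lyndon_condition_def by blast

text \<open>Describes the domain by sequences without ascents, which also describe the ascent-free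
  chains. A decreasing sequence exists for every normalized forest, and the Lyndon conditions then
  exclude ascents.\<close>

lemma pointed_lyndon_forest_builds:
  "F \<in> pointed_lyndon_forests n \<longleftrightarrow> (\<exists>vs. builds n vs F \<and> no_ascents vs)"
proof
  assume F: "F \<in> pointed_lyndon_forests n"
  then obtain vs where vs: "builds n vs F" "valency_decreasing vs"
    using builds_exists unfolding pointed_lyndon_forest_iff by blast
  then show "\<exists>vs. builds n vs F \<and> no_ascents vs"
    using F no_ascents_iff[OF vs(1)] builds_set[OF vs(1)] unfolding pointed_lyndon_forest_iff by auto
next
  assume "\<exists>vs. builds n vs F \<and> no_ascents vs"
  then obtain vs where vs: "builds n vs F" "no_ascents vs" by blast
  then show "F \<in> pointed_lyndon_forests n"
    using no_ascents_iff[OF vs(1)] builds_set[OF vs(1)] builds_normalized_forest[OF vs(1)]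
    unfolding pointed_lyndon_forest_iff by auto
qed

lemma forest_chain_builds:
  "builds n vs F \<Longrightarrow> no_ascents vs \<Longrightarrow> forest_chain n F = merge_chain (zero_hat n) vs"
  using no_ascents_iff reverse_minimal_extension_eq unfolding forest_chain_def by metis

theorem theorem3p6:
  fixes n :: nat
  assumes "n \<ge> 1"
  shows "bij_betw (forest_chain n) (pointed_lyndon_forests n)
           {cs \<in> saturated_chains_from_zero n. ascent_free cs}"
proof (rule bij_betw_imageI)
  show "inj_on (forest_chain n) (pointed_lyndon_forests n)"
  proof (rule inj_onI)
    fix F G
    assume "F \<in> pointed_lyndon_forests n" "G \<in> pointed_lyndon_forests n"
      and eq: "forest_chain n F = forest_chain n G"
    then obtain vs ws where vs: "builds n vs F" "no_ascents vs" and ws: "builds n ws G" "no_ascents ws"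
      unfolding pointed_lyndon_forest_builds by blast
    \<comment> \<open>Injectivity uses only the labels of the chains.\<close>
    then have "map vertex_label vs = map vertex_label ws"
      using eq forest_chain_builds chain_labels_merge_chain by metis
    then show "F = G" using labels_determine_forest vs ws by blast
  qed
  show "forest_chain n ` pointed_lyndon_forests n =
      {cs \<in> saturated_chains_from_zero n. ascent_free cs}"
  proof (intro set_eqI iffI)
    fix cs assume "cs \<in> forest_chain n ` pointed_lyndon_forests n"
    then obtain F where F: "F \<in> pointed_lyndon_forests n" "cs = forest_chain n F" by blast
    then obtain vs where "builds n vs F" "no_ascents vs"
      unfolding pointed_lyndon_forest_builds by blast
    then show "cs \<in> {cs \<in> saturated_chains_from_zero n. ascent_free cs}"
      using F(2) by (simp add: forest_chain_builds merge_chain_saturated ascent_free_merge_chain)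
  next
    fix cs assume cs: "cs \<in> {cs \<in> saturated_chains_from_zero n. ascent_free cs}"
    then obtain vs F where vs: "builds n vs F" "cs = merge_chain (zero_hat n) vs"
      using saturated_chain_builds by blast
    have na: "no_ascents vs" using cs ascent_free_merge_chain[OF vs(1)] vs(2) by simp
    have "F \<in> pointed_lyndon_forests n" using vs(1) na pointed_lyndon_forest_builds by blast
    then show "cs \<in> forest_chain n ` pointed_lyndon_forests n"
      using forest_chain_builds[OF vs(1) na] vs(2) by (intro image_eqI[of _ _ F]) auto
  qed
qed

end
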